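(* Let $c_B>0$ and let $\mathcal{A}_{t,r}$ denote the event $\{W^{0,r}_{[0,t]}\subseteq\mathcal{B}(0,c_B\sqrt t)\}$. For every $d\geq4$ there is a constant $c\in(0,\infty)$ depending only on $d$ such that for all $t\geq1$ and $r\in(0,1)$, $$\mathrm{E}\big[\mathrm{cap}(W^{0,r}_{[0,t]})\,\mathbf{1}_{\mathcal{A}_{t,r}}\big]\geq c\,\mathrm{P}(\mathcal{A}_{t,r})^2\times\begin{cases} t\,r^{d-4} & \text{if } d\geq5,\\[2pt] \dfrac{t}{\log(tr^{-2})} & \text{if } d=4.\end{cases}$$
   Context: $B^0$ is a standard Brownian motion in $\mathbb{R}^d$ started at $0$, with probability and expectation $\mathrm{P},\mathrm{E}$, and $W^{0,r}_{[0,t]}=\bigcup_{0\le s\le t}\mathcal{B}(B^0_s,r)$ is the Wiener sausage of radius $r$, where $\mathcal{B}(z,r)$ is the open Euclidean ball with center $z$ and radius $r$. For a bounded Borel set $A\subseteq\mathbb{R}^d$, the Newtonian capacity is $\mathrm{cap}(A)=\big[\inf_\nu\int_A\int_A G(x,y)\,\nu(\mathrm{d}x)\,\nu(\mathrm{d}y)\big]^{-1}$, the infimum being over all probability measures $\nu$ on $A$, with $G(x,y)=\frac{\Gamma(d/2-1)}{2\pi^{d/2}\|x-y\|^{d-2}}$.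
   Formalization: For d=4 the logarithm log(tr^{-2}) is replaced by max(1, log(tr^{-2})); the literal bound fails for t=1, c_B>1, r→1, where its right side is unbounded while the capacity is at most that of the ball of radius c_B. Nothing changes when tr^{-2} ≥ e. *)

theory Defs
  imports "HOL-Probability.Probability"
begin

definition standard_brownian_motion ::
  "'w measure \<Rightarrow> (real \<Rightarrow> 'w \<Rightarrow> real ^ 'n) \<Rightarrow> bool" where
  "standard_brownian_motion M B \<longleftrightarrow>
     prob_space M \<and>
     (\<forall>t\<ge>0. B t \<in> borel_measurable M) \<and>
     (\<forall>\<omega>\<in>space M. B 0 \<omega> = 0) \<and>
     (\<forall>\<omega>\<in>space M. continuous_on {0..} (\<lambda>t. B t \<omega>)) \<and>
     (\<forall>s t. 0 \<le> s \<and> s < t \<longrightarrow>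
        distributed M lborel (\<lambda>\<omega>. B t \<omega> - B s \<omega>)
          (\<lambda>x. ennreal (\<Prod>i\<in>UNIV. normal_density 0 (sqrt (t - s)) (x $ i)))) \<and>
     (\<forall>(n::nat) \<tau>. mono \<tau> \<and> 0 \<le> \<tau> 0 \<longrightarrow>
        prob_space.indep_vars M (\<lambda>_. borel)
          (\<lambda>k \<omega>. B (\<tau> (Suc k)) \<omega> - B (\<tau> k) \<omega>) {..<n})"

definition wiener_sausage ::
  "(real \<Rightarrow> 'w \<Rightarrow> real ^ 'n) \<Rightarrow> real \<Rightarrow> real \<Rightarrow> 'w \<Rightarrow> (real ^ 'n) set" where
  "wiener_sausage B r t \<omega> = (\<Union>s\<in>{0..t}. ball (B s \<omega>) r)"

(* The division takes place in ennreal, so that G(x,x) = \<infinity> in dimension at least 3.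
   Real division would give G(x,x) = 0, and point masses would then have zero energy. *)
definition newton_green :: "real ^ 'n \<Rightarrow> real ^ 'n \<Rightarrow> ennreal" where
  "newton_green x y =
     ennreal (Gamma (real CARD('n) / 2 - 1) / (2 * pi powr (real CARD('n) / 2))) /
     ennreal (norm (x - y) ^ (CARD('n) - 2))"

(* The inverse is that of ennreal: the capacity is 0 if every energy is infinite or if A
   carries no probability measure (A empty). Intended for bounded Borel sets A. *)
definition newton_capacity :: "(real ^ 'n) set \<Rightarrow> ennreal" where
  "newton_capacity A =
     inverse (INF \<nu>\<in>{\<nu>. prob_space \<nu> \<and> sets \<nu> = sets borel \<and> emeasure \<nu> A = 1}.
       \<integral>\<^sup>+x\<in>A. (\<integral>\<^sup>+y\<in>A. newton_green x y \<partial>\<nu>) \<partial>\<nu>)"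

definition confinement_event ::
  "'w measure \<Rightarrow> (real \<Rightarrow> 'w \<Rightarrow> real ^ 'n) \<Rightarrow> real \<Rightarrow> real \<Rightarrow> real \<Rightarrow> 'w set" where
  "confinement_event M B c\<^sub>B t r =
     {\<omega> \<in> space M. wiener_sausage B r t \<omega> \<subseteq> ball 0 (c\<^sub>B * sqrt t)}"

(* In dimension 4 the logarithm is bounded below by 1. With log(t r^{-2}) itself, a lower
   bound c P(A)^2 t / log(t r^{-2}), with c independent of t >= 1 and 0 < r < 1, fails:
   for t = 1 and r -> 1 it is unbounded as soon as c_B > 1, whereas the capacity on the
   confinement event never exceeds that of the ball of radius c_B sqrt(t). Nothing changes
   when t r^{-2} >= e. *)
definition sausage_capacity_rate :: "nat \<Rightarrow> real \<Rightarrow> real \<Rightarrow> real" where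
  "sausage_capacity_rate d t r =
     (if d \<ge> 5 then t * r ^ (d - 4) else t / max 1 (ln (t * r powi (-2))))"

end

theory Submission imports Defs begin

text \<open>
  Sample Brownian motion at the \<open>N = \<lfloor>t / r\<^sup>2\<rfloor>\<close> times \<open>j r\<^sup>2\<close> and smear each sample uniformly over a
  ball of radius \<open>r\<close>: this gives a random probability measure on the sausage, whose energy \<open>e\<close>
  satisfies \<open>1 / e \<le> cap\<close>. The Green function has mean at most of order \<open>R ^ (2 - d)\<close> against any law whose mass of
  every ball of radius \<open>\<rho>\<close> is of order at most \<open>(\<rho> / R)\<^sup>d\<close>. With \<open>R = r\<close> this bounds the diagonal terms
  of the energy, and with \<open>R = r sqrt \<bar>j - k\<bar>\<close> the expectation of the others, so that \<open>E e\<close> is at most of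
  order \<open>r ^ (2 - d) / N\<close> times a partial sum of \<open>\<Sum> m powr (1 - d / 2)\<close>, which is bounded for \<open>d \<ge> 5\<close> and logarithmic
  for \<open>d = 4\<close>. Finally \<open>E[1\<^sub>A / e] \<ge> P(A)\<^sup>2 / E e\<close> by Cauchy--Schwarz.
\<close>

section \<open>Negative moments from small ball estimates\<close>

text \<open>If \<open>x \<ge> R\<close>, the summand 1 suffices. Otherwise
  \<open>R / 2 ^ Suc k \<le> x < R / 2 ^ k\<close> for some \<open>k\<close>, and the single term at
  \<open>k\<close> already dominates. The indicators will integrate to small ball
  probabilities.\<close>

lemma inverse_power_le_dyadic_sum:
  fixes x R :: real
  assumes "0 < x" "0 < R"
  shows "inverse (ennreal (x ^ p)) \<le>
    ennreal (1 / R ^ p) * (1 + (\<Sum>k. ennreal (2 ^ (Suc k * p)) * indicator {y. y < R / 2 ^ k} x))"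
    (is "_ \<le> _ * (1 + (\<Sum>k. ?f k))")
proof (cases "x < R")
  case False
  then have "inverse (x ^ p) \<le> 1 / R ^ p"
    using assms by (auto simp: divide_simps intro!: power_mono)
  then have "inverse (ennreal (x ^ p)) \<le> ennreal (1 / R ^ p) * 1"
    using assms by (simp add: inverse_ennreal)
  also have "\<dots> \<le> ennreal (1 / R ^ p) * (1 + (\<Sum>k. ?f k))"
    by (intro mult_left_mono) auto
  finally show ?thesis .
next
  case True
  have le_suminf: "g k \<le> (\<Sum>k. g k)" for g :: "nat \<Rightarrow> ennreal" and k
    using sum_le_suminf[of g "{k}"] by simp
  obtain m where "(1 / 2) ^ m < x / R"
    using real_arch_pow_inv[of "x / R" "1/2"] assms by auto
  then have ex: "R / 2 ^ m \<le> x"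
    using assms by (simp add: field_simps)
  define n where "n = (LEAST n. R / 2 ^ n \<le> x)"
  have n: "R / 2 ^ n \<le> x" unfolding n_def using ex by (rule LeastI)
  with True obtain k where k: "n = Suc k" by (cases n) auto
  have "\<not> R / 2 ^ k \<le> x"
    using not_less_Least[of k "\<lambda>n. R / 2 ^ n \<le> x"] k unfolding n_def by auto
  then have kx: "x < R / 2 ^ k" by simp
  have "R ^ p \<le> (x * 2 ^ Suc k) ^ p"
    using n k assms by (intro power_mono) (auto simp: field_simps)
  then have "R ^ p \<le> x ^ p * 2 ^ (Suc k * p)"
    by (simp only: power_mult_distrib power_mult)
  then have "inverse (x ^ p) \<le> 1 / R ^ p * 2 ^ (Suc k * p)"
    using assms by (simp add: field_simps)
  then have "inverse (ennreal (x ^ p)) \<le> ennreal (1 / R ^ p * 2 ^ (Suc k * p))"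
    using assms by (simp add: inverse_ennreal)
  also have "\<dots> = ennreal (1 / R ^ p) * ?f k"
    using kx assms by (simp flip: ennreal_mult)
  also have "?f k \<le> (\<Sum>k. ?f k)"
    by (rule le_suminf)
  also have "(\<Sum>k. ?f k) \<le> 1 + (\<Sum>k. ?f k)" by simp
  finally show ?thesis by (simp add: mult_left_mono)
qed

text \<open>In the integrated dyadic bound, the ball of radius \<open>R / 2 ^ k\<close> has weight
  of order 2^(kp) and mass of order 2^(-k(p+2)). The two surplus powers leave the convergent series
  of \<open>(1 / 4) ^ k\<close>.\<close>

lemma (in prob_space) nn_integral_inverse_norm_power_le:
  fixes X :: "'a \<Rightarrow> 'b::euclidean_space"
  assumes X[measurable]: "X \<in> borel_measurable M"
    and "0 < R" "0 \<le> C"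
    and small: "\<And>\<rho>. 0 < \<rho> \<Longrightarrow>
      emeasure M {\<omega>\<in>space M. norm (X \<omega>) < \<rho>} \<le> ennreal (C * (\<rho> / R) ^ (p + 2))"
  shows "(\<integral>\<^sup>+\<omega>. inverse (ennreal (norm (X \<omega>) ^ p)) \<partial>M) \<le> ennreal ((1 + C * 2 ^ (p + 1)) / R ^ p)"
proof -
  let ?E = "\<lambda>k::nat. {\<omega>\<in>space M. norm (X \<omega>) < R / 2 ^ k}"
  have smallE: "emeasure M (?E k) \<le> ennreal (C * ((1 / 2) ^ k) ^ (p + 2))" for k
    using small[of "R / 2 ^ k"] \<open>0 < R\<close> by (simp add: field_simps)
  \<comment> \<open>The dyadic bound is stated for positive norms. The zero set lies in every
    \<open>?E k\<close>, so it is null.\<close>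
  have "emeasure M {\<omega>\<in>space M. X \<omega> = 0} \<le> 0"
  proof (rule LIMSEQ_le_const)
    have "(\<lambda>k. C * ((1 / 2 :: real) ^ k) ^ (p + 2)) \<longlonglongrightarrow> C * 0 ^ (p + 2)"
      by (intro tendsto_intros LIMSEQ_power_zero) auto
    then show "(\<lambda>k. ennreal (C * ((1 / 2) ^ k) ^ (p + 2))) \<longlonglongrightarrow> 0"
      using tendsto_ennrealI by fastforce
    have "emeasure M {\<omega>\<in>space M. X \<omega> = 0} \<le> emeasure M (?E k)" for k
      using \<open>0 < R\<close> by (intro emeasure_mono) auto
    then show "\<exists>N. \<forall>k\<ge>N. emeasure M {\<omega>\<in>space M. X \<omega> = 0} \<le> ennreal (C * ((1 / 2) ^ k) ^ (p + 2))"
      using smallE order_trans by blast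
  qed
  then have "AE \<omega> in M. X \<omega> \<noteq> 0"
    by (subst AE_iff_measurable[of "{\<omega>\<in>space M. X \<omega> = 0}"]) auto
  then have "(\<integral>\<^sup>+\<omega>. inverse (ennreal (norm (X \<omega>) ^ p)) \<partial>M) \<le>
      (\<integral>\<^sup>+\<omega>. ennreal (1 / R ^ p) *
        (1 + (\<Sum>k. ennreal (2 ^ (Suc k * p)) * indicator {y. y < R / 2 ^ k} (norm (X \<omega>)))) \<partial>M)"
    using inverse_power_le_dyadic_sum[OF _ \<open>0 < R\<close>]
    by (intro nn_integral_mono_AE) (auto elim!: eventually_mono)
  also have "\<dots> = ennreal (1 / R ^ p) *
      (1 + (\<Sum>k. ennreal (2 ^ (Suc k * p)) * (\<integral>\<^sup>+\<omega>. indicator {y. y < R / 2 ^ k} (norm (X \<omega>)) \<partial>M)))"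
    by (simp add: nn_integral_cmult nn_integral_add nn_integral_suminf emeasure_space_1)
  also have "(\<lambda>k. \<integral>\<^sup>+\<omega>. indicator {y. y < R / 2 ^ k} (norm (X \<omega>)) \<partial>M) = (\<lambda>k. emeasure M (?E k))"
  proof
    fix k
    have "(\<integral>\<^sup>+\<omega>. indicator {y. y < R / 2 ^ k} (norm (X \<omega>)) \<partial>M) = (\<integral>\<^sup>+\<omega>. indicator (?E k) \<omega> \<partial>M)"
      by (intro nn_integral_cong) (auto simp: indicator_def)
    then show "(\<integral>\<^sup>+\<omega>. indicator {y. y < R / 2 ^ k} (norm (X \<omega>)) \<partial>M) = emeasure M (?E k)"
      by simp
  qed
  also have "ennreal (1 / R ^ p) * (1 + (\<Sum>k. ennreal (2 ^ (Suc k * p)) * emeasure M (?E k)))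
      \<le> ennreal (1 / R ^ p) * (1 + ennreal (C * 2 ^ (p + 1)))"
  proof (intro mult_left_mono add_left_mono)
    have *: "2 ^ (Suc k * p) * (C * ((1 / 2) ^ k) ^ (p + 2)) = C * 2 ^ p * (1 / 4) ^ k" for k
    proof -
      have "((1 / 2 :: real) ^ k) ^ (p + 2) = (1 / 2) ^ (k * p) * (1 / 4) ^ k"
        by (simp add: power_add power_mult power2_eq_square flip: power_mult_distrib)
      then show ?thesis by (simp add: power_add power_one_over field_simps)
    qed
    have "(\<Sum>k. ennreal (2 ^ (Suc k * p)) * emeasure M (?E k)) \<le>
        (\<Sum>k. ennreal (2 ^ (Suc k * p)) * ennreal (C * ((1 / 2) ^ k) ^ (p + 2)))"
      by (intro suminf_le mult_left_mono smallE) auto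
    also have "\<dots> = (\<Sum>k. ennreal (C * 2 ^ p * (1 / 4) ^ k))"
    proof (intro suminf_cong)
      fix k
      have "ennreal (2 ^ (Suc k * p)) * ennreal (C * ((1 / 2) ^ k) ^ (p + 2)) =
          ennreal (2 ^ (Suc k * p) * (C * ((1 / 2) ^ k) ^ (p + 2)))"
        using \<open>0 \<le> C\<close> by (intro ennreal_mult[symmetric]) auto
      then show "ennreal (2 ^ (Suc k * p)) * ennreal (C * ((1 / 2) ^ k) ^ (p + 2)) =
          ennreal (C * 2 ^ p * (1 / 4) ^ k)"
        by (simp only: *)
    qed
    also have "\<dots> = ennreal (C * 2 ^ p * (1 / (1 - 1 / 4)))"
      using \<open>0 \<le> C\<close> by (intro suminf_ennreal_eq sums_mult geometric_sums) auto
    \<comment> \<open>The geometric series sums to 4/3, rounded up to 2.\<close>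
    also have "\<dots> \<le> ennreal (C * 2 ^ (p + 1))"
      using \<open>0 \<le> C\<close> by (intro ennreal_leI) (simp add: field_simps)
    finally show "(\<Sum>k. ennreal (2 ^ (Suc k * p)) * emeasure M (?E k)) \<le> ennreal (C * 2 ^ (p + 1))" .
  qed auto
  also have "\<dots> = ennreal ((1 + C * 2 ^ (p + 1)) / R ^ p)"
    using \<open>0 \<le> C\<close> \<open>0 < R\<close>
    by (subst ennreal_1[symmetric], subst ennreal_plus[symmetric])
       (auto simp flip: ennreal_mult ennreal_plus simp: field_simps)
  finally show ?thesis .
qed

section \<open>Uniform and Gaussian laws\<close>

lemma prob_space_uniform_ball:
  "0 < r \<Longrightarrow> prob_space (uniform_measure lborel (ball (z::'b::euclidean_space) r))"
  using content_ball_pos[of r z] emeasure_lborel_ball_finite[of z r]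
  by (intro prob_space_uniform_measure) (auto simp: measure_def)

text \<open>Whatever the shift \<open>z\<close>, a ball of radius \<open>\<rho>\<close> has mass at
  most the ratio of volumes \<open>(\<rho> / r) ^ (p + 2)\<close>, a small ball estimate at scale
  \<open>r\<close> with constant 1.\<close>

lemma nn_integral_uniform_ball_inverse_norm_power_le:
  fixes z :: "'b::euclidean_space"
  assumes "0 < r" "DIM('b) = p + 2"
  shows "(\<integral>\<^sup>+x. inverse (ennreal (norm (z + x) ^ p)) \<partial>uniform_measure lborel (ball 0 r))
    \<le> ennreal ((1 + 2 ^ (p + 1)) / r ^ p)"
proof -
  let ?U = "uniform_measure lborel (ball (0::'b) r)"
  have v: "0 < unit_ball_vol (DIM('b))" by simp
  interpret prob_space ?U using assms(1) by (rule prob_space_uniform_ball)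
  show ?thesis
  proof (rule order_trans[OF nn_integral_inverse_norm_power_le[where R = r and C = 1]])
    fix \<rho> :: real assume "0 < \<rho>"
    have "{x \<in> space ?U. norm (z + x) < \<rho>} = ball (- z) \<rho>"
      by (auto simp: dist_norm norm_minus_commute add.commute)
    then have "emeasure ?U {x \<in> space ?U. norm (z + x) < \<rho>} =
        emeasure lborel (ball 0 r \<inter> ball (- z) \<rho>) / emeasure lborel (ball (0::'b) r)"
      by simp
    also have "\<dots> \<le> emeasure lborel (ball (- z) \<rho>) / emeasure lborel (ball (0::'b) r)"
      by (intro divide_right_mono_ennreal emeasure_mono) auto
    also have "\<dots> = ennreal (1 * (\<rho> / r) ^ (p + 2))"
      using \<open>0 < \<rho>\<close> assms v less_imp_neq[OF v]
      by (simp add: emeasure_ball divide_ennreal field_simps power_divide)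
    finally show "emeasure ?U {x \<in> space ?U. norm (z + x) < \<rho>} \<le> ennreal (1 * (\<rho> / r) ^ (p + 2))" .
  qed (use assms in auto)
qed

text \<open>The density never exceeds \<open>(1 / sqrt s) ^ (p + 2)\<close>, so a ball about any
  centre has mass at most its volume times this. The scale is \<open>sqrt s\<close>, and the
  constant is the volume of the unit ball.\<close>

lemma nn_integral_gaussian_inverse_norm_power_le:
  fixes X :: "'a \<Rightarrow> real ^ 'n" and w :: "real ^ 'n"
  assumes "prob_space M" "0 < s" "CARD('n) = p + 2"
    and X: "distributed M lborel X (\<lambda>x. ennreal (\<Prod>i\<in>UNIV. normal_density 0 (sqrt s) (x $ i)))"
  shows "(\<integral>\<^sup>+\<omega>. inverse (ennreal (norm (X \<omega> + w) ^ p)) \<partial>M)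
    \<le> ennreal ((1 + unit_ball_vol (CARD('n)) * 2 ^ (p + 1)) / sqrt s ^ p)"
proof -
  interpret prob_space M by fact
  have [measurable]: "X \<in> borel_measurable M"
    using distributed_measurable[OF X] by simp
  have v: "0 \<le> unit_ball_vol (CARD('n))" by simp
  have dens: "(\<Prod>i\<in>UNIV. normal_density 0 (sqrt s) (x $ i)) \<le> (1 / sqrt s) ^ (p + 2)" for x :: "real ^ 'n"
  proof -
    have "normal_density 0 (sqrt s) y \<le> 1 / sqrt s" for y
    proof -
      have "sqrt s \<le> sqrt (2 * pi * s)"
        using \<open>0 < s\<close> pi_gt3 by (intro real_sqrt_le_mono) simp
      then have "1 / sqrt (2 * pi * s) \<le> 1 / sqrt s"
        using \<open>0 < s\<close> by (intro divide_left_mono) auto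
      moreover have "normal_density 0 (sqrt s) y \<le> 1 / sqrt (2 * pi * s) * 1"
        unfolding normal_density_def using \<open>0 < s\<close> by (intro mult_mono) auto
      ultimately show ?thesis by simp
    qed
    then have "(\<Prod>i\<in>UNIV. normal_density 0 (sqrt s) (x $ i)) \<le> (\<Prod>i\<in>(UNIV::'n set). 1 / sqrt s)"
      by (intro prod_mono) auto
    then show ?thesis using assms by simp
  qed
  show ?thesis
  proof (rule nn_integral_inverse_norm_power_le)
    fix \<rho> :: real assume "0 < \<rho>"
    have "{\<omega> \<in> space M. norm (X \<omega> + w) < \<rho>} = X -` ball (- w) \<rho> \<inter> space M"
      by (auto simp: dist_norm norm_minus_commute add.commute)
         (metis add.commute diff_minus_eq_add minus_diff_eq norm_minus_cancel)+
    then have "emeasure M {\<omega> \<in> space M. norm (X \<omega> + w) < \<rho>} =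
       (\<integral>\<^sup>+x. ennreal (\<Prod>i\<in>UNIV. normal_density 0 (sqrt s) (x $ i)) * indicator (ball (- w) \<rho>) x \<partial>lborel)"
      using distributed_emeasure[OF X, of "ball (- w) \<rho>"] by simp
    also have "\<dots> \<le> (\<integral>\<^sup>+x. ennreal ((1 / sqrt s) ^ (p + 2)) * indicator (ball (- w) \<rho>) x \<partial>lborel)"
      by (intro nn_integral_mono mult_right_mono ennreal_leI dens) auto
    also have "\<dots> = ennreal (unit_ball_vol (CARD('n)) * (\<rho> / sqrt s) ^ (p + 2))"
      using \<open>0 < \<rho>\<close> \<open>0 < s\<close> v assms
      by (simp add: emeasure_ball nn_integral_cmult_indicator flip: ennreal_mult) (simp add: field_simps power_divide)
    finally show "emeasure M {\<omega> \<in> space M. norm (X \<omega> + w) < \<rho>}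
      \<le> ennreal (unit_ball_vol (CARD('n)) * (\<rho> / sqrt s) ^ (p + 2))" .
  qed (use assms v in auto)
qed

section \<open>Capacity, energy and the second moment method\<close>

text \<open>
  The function \<open>f\<close> need not be measurable: \<open>\<integral>\<^sup>+\<close> is then a lower integral, and the bound on it comes
  from integrating \<open>2 \<lambda> \<le> 1 / e + \<lambda>\<^sup>2 e\<close> for a well-chosen \<open>\<lambda>\<close>, which is a form of the
  Cauchy--Schwarz inequality.
\<close>

lemma (in prob_space) nn_integral_ge_square_prob_div:
  fixes e f :: "'a \<Rightarrow> ennreal"
  assumes [measurable]: "A \<in> sets M" "e \<in> borel_measurable M"
    and e: "(\<integral>\<^sup>+\<omega>. e \<omega> \<partial>M) \<le> ennreal K" and "0 < K"
    and f: "\<And>\<omega>. \<omega> \<in> A \<Longrightarrow> inverse (e \<omega>) \<le> f \<omega>"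
  shows "ennreal ((prob A)\<^sup>2 / K) \<le> (\<integral>\<^sup>+\<omega>. f \<omega> * indicator A \<omega> \<partial>M)"
proof (cases "prob A = 0")
  case False
  then have P: "0 < prob A" using measure_nonneg[of M A] by linarith
  \<comment> \<open>With P = \<open>prob A\<close>, this value maximises 2lP - l^2 K, and the
    maximum is P^2 / K.\<close>
  define l where "l = prob A / K"
  have l: "0 < l" using P \<open>0 < K\<close> by (simp add: l_def)
  \<comment> \<open>For finite positive \<open>x\<close> this is
    \<open>(l * y - 1)^2 / y \<ge> 0\<close> expanded; for \<open>x\<close> zero or infinite the
    right side is infinite.\<close>
  have young: "ennreal (2 * l) \<le> inverse x + ennreal (l\<^sup>2) * x" for x
  proof (cases x)
    case (real y)
    show ?thesis
    proof (cases "y = 0")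
      case False
      have "0 \<le> (l * y - 1)\<^sup>2 / y" using real by simp
      also have "(l * y - 1)\<^sup>2 / y = inverse y + l\<^sup>2 * y - 2 * l"
        using False by (simp add: field_simps power2_eq_square)
      finally show ?thesis
        using real False l by (simp add: inverse_ennreal flip: ennreal_mult ennreal_plus)
    qed (use real in auto)
  qed (use l in \<open>auto simp: ennreal_mult_top\<close>)
  \<comment> \<open>The truncated difference \<open>?h \<omega> - ?g \<omega>\<close> is a
    measurable minorant of \<open>f \<omega> * indicator A \<omega>\<close>: additivity of the
    integral is applied to the difference, monotonicity alone to \<open>f\<close>.\<close>
  let ?h = "\<lambda>\<omega>. ennreal (2 * l) * indicator A \<omega>" and ?g = "\<lambda>\<omega>. ennreal (l\<^sup>2) * e \<omega>"
  have "ennreal (2 * l * prob A) = (\<integral>\<^sup>+\<omega>. ?h \<omega> \<partial>M)"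
    using l by (simp add: nn_integral_cmult_indicator emeasure_eq_measure ennreal_mult)
  also have "\<dots> \<le> (\<integral>\<^sup>+\<omega>. (?h \<omega> - ?g \<omega>) + ?g \<omega> \<partial>M)"
  proof (intro nn_integral_mono)
    show "?h \<omega> \<le> (?h \<omega> - ?g \<omega>) + ?g \<omega>" for \<omega>
      using ennreal_minus_le_iff[of "?h \<omega>" "?g \<omega>" "?h \<omega> - ?g \<omega>"] by (simp add: add.commute)
  qed
  also have "\<dots> = (\<integral>\<^sup>+\<omega>. ?h \<omega> - ?g \<omega> \<partial>M) + ennreal (l\<^sup>2) * (\<integral>\<^sup>+\<omega>. e \<omega> \<partial>M)"
    by (simp add: nn_integral_add nn_integral_cmult)
  also have "\<dots> \<le> (\<integral>\<^sup>+\<omega>. f \<omega> * indicator A \<omega> \<partial>M) + ennreal (l\<^sup>2) * ennreal K"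
  proof (intro add_mono nn_integral_mono mult_left_mono e)
    fix \<omega>
    have "?h \<omega> \<le> ?g \<omega> + f \<omega> * indicator A \<omega>"
    proof (cases "\<omega> \<in> A")
      case True
      have "ennreal (2 * l) \<le> inverse (e \<omega>) + ?g \<omega>" by (rule young)
      also have "\<dots> \<le> f \<omega> + ?g \<omega>" using f[OF True] by (intro add_right_mono)
      finally show ?thesis using True by (simp add: add.commute)
    qed auto
    then show "?h \<omega> - ?g \<omega> \<le> f \<omega> * indicator A \<omega>"
      by (auto simp: ennreal_minus_le_iff ennreal_mult_eq_top_iff indicator_def split: if_splits)
  qed auto
  finally have "ennreal (2 * l * prob A) - ennreal (l\<^sup>2 * K) \<le> (\<integral>\<^sup>+\<omega>. f \<omega> * indicator A \<omega> \<partial>M)"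
    using \<open>0 < K\<close> by (simp add: ennreal_minus_le_iff add.commute ennreal_mult)
  moreover have "ennreal (2 * l * prob A) - ennreal (l\<^sup>2 * K) = ennreal ((prob A)\<^sup>2 / K)"
    using \<open>0 < K\<close> by (simp add: ennreal_minus l_def power2_eq_square)
  ultimately show ?thesis by simp
qed auto

section \<open>Smeared point measures and their energy\<close>

text \<open>For \<open>0 < N\<close>, the equal-weight mixture of the uniform laws on the balls of
  radius \<open>r\<close> about the first \<open>N\<close> points. As an image of a product it
  counts coinciding points with multiplicity, and its integrals come from Fubini.\<close>

definition smeared_points :: "(nat \<Rightarrow> real ^ 'n) \<Rightarrow> nat \<Rightarrow> real \<Rightarrow> (real ^ 'n) measure" where
  "smeared_points a N r =
     distr (measure_pmf (pmf_of_set {..<N}) \<Otimes>\<^sub>M uniform_measure lborel (ball 0 r)) borel (\<lambda>(j, x). a j + x)"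

lemma measurable_smear:
  fixes a :: "nat \<Rightarrow> real ^ 'n"
  shows "(\<lambda>(j, x). a j + x) \<in>
     measure_pmf q \<Otimes>\<^sub>M uniform_measure lborel (ball 0 r) \<rightarrow>\<^sub>M (borel :: (real ^ 'n) measure)"
proof -
  have *: "sets (measure_pmf q \<Otimes>\<^sub>M uniform_measure lborel (ball (0 :: real ^ 'n) r)) =
      sets (count_space UNIV \<Otimes>\<^sub>M borel)"
    by (intro sets_pair_measure_cong) auto
  have "(\<lambda>(j, x). a j + x) \<in> count_space UNIV \<Otimes>\<^sub>M borel \<rightarrow>\<^sub>M (borel :: (real ^ 'n) measure)"
    by (intro measurable_pair_measure_countable1) (auto intro: countableI_type)
  then show ?thesis using measurable_cong_sets[OF * refl] by blast
qed

lemma prob_space_smeared_points: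
  fixes a :: "nat \<Rightarrow> real ^ 'n"
  assumes "0 < r"
  shows "prob_space (smeared_points a N r)"
proof -
  interpret U: prob_space "uniform_measure lborel (ball (0 :: real ^ 'n) r)"
    using assms by (rule prob_space_uniform_ball)
  interpret Q: prob_space "measure_pmf (pmf_of_set {..<N})"
    by (rule prob_space_measure_pmf)
  interpret P: pair_prob_space "measure_pmf (pmf_of_set {..<N})" "uniform_measure lborel (ball (0 :: real ^ 'n) r)" ..
  show ?thesis unfolding smeared_points_def by (rule P.P.prob_space_distr[OF measurable_smear])
qed

lemma nn_integral_smeared_points:
  fixes a :: "nat \<Rightarrow> real ^ 'n"
  assumes "0 < r" "0 < N" and [measurable]: "f \<in> borel_measurable borel"
  shows "(\<integral>\<^sup>+x. f x \<partial>smeared_points a N r) =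
    (\<Sum>j<N. \<integral>\<^sup>+x. f (a j + x) \<partial>uniform_measure lborel (ball 0 r)) / of_nat N"
proof -
  interpret U: prob_space "uniform_measure lborel (ball (0 :: real ^ 'n) r)"
    using assms(1) by (rule prob_space_uniform_ball)
  have "(\<integral>\<^sup>+x. f x \<partial>smeared_points a N r) =
      (\<integral>\<^sup>+j. \<integral>\<^sup>+x. f (a j + x) \<partial>uniform_measure lborel (ball 0 r) \<partial>measure_pmf (pmf_of_set {..<N}))"
    unfolding smeared_points_def
    by (subst nn_integral_distr)
       (auto simp: U.nn_integral_fst[symmetric] measurable_compose[OF measurable_smear] case_prod_beta)
  then show ?thesis using assms by (simp add: nn_integral_pmf_of_set lessThan_empty_iff)
qed

lemma measurable_newton_green[measurable]:
  assumes [measurable]: "f \<in> borel_measurable M" "g \<in> borel_measurable M"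
  shows "(\<lambda>x. newton_green (f x :: real ^ 'n) (g x)) \<in> borel_measurable M"
  unfolding newton_green_def by measurable

lemma inverse_ennreal_antimono:
  fixes x y :: ennreal
  assumes "x \<le> y"
  shows "inverse y \<le> inverse x"
proof (cases x; cases y)
  fix a b assume ab: "x = ennreal a" "0 \<le> a" "y = ennreal b" "0 \<le> b"
  then have "a \<le> b" using assms by simp
  then show ?thesis
    using ab by (cases "a = 0") (auto simp: inverse_ennreal intro!: ennreal_leI le_imp_inverse_le)
qed (use assms in \<open>auto simp: top_unique\<close>)

text \<open>The smeared measure competes in the infimum that defines the capacity; the inverted
  expression is an upper bound for its energy on \<open>S\<close>.\<close>

lemma newton_capacity_ge:
  fixes a :: "nat \<Rightarrow> real ^ 'n"
  assumes "0 < r" "0 < N" and [measurable]: "S \<in> sets borel"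
    and sub: "\<And>j. j < N \<Longrightarrow> ball (a j) r \<subseteq> S"
  shows "inverse ((\<Sum>j<N. \<Sum>k<N. \<integral>\<^sup>+x. \<integral>\<^sup>+y. newton_green (a j + x) (a k + y)
      \<partial>uniform_measure lborel (ball 0 r) \<partial>uniform_measure lborel (ball 0 r)) / of_nat N / of_nat N)
    \<le> newton_capacity S"
proof -
  let ?\<nu> = "smeared_points a N r"
  let ?U = "uniform_measure lborel (ball (0 :: real ^ 'n) r)"
  interpret U: prob_space ?U using assms(1) by (rule prob_space_uniform_ball)
  interpret \<nu>: prob_space ?\<nu> using assms(1) by (rule prob_space_smeared_points)
  have [measurable_cong]: "sets ?\<nu> = sets borel" by (simp add: smeared_points_def)
  have [measurable_cong]: "sets ?U = sets borel" by simp
  have "emeasure ?\<nu> S = (\<integral>\<^sup>+x. indicator S x \<partial>?\<nu>)" by simp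
  also have "\<dots> = (\<Sum>j<N. \<integral>\<^sup>+x. indicator S (a j + x) \<partial>?U) / of_nat N"
    using assms by (intro nn_integral_smeared_points) auto
  also have "(\<Sum>j<N. \<integral>\<^sup>+x. indicator S (a j + x) \<partial>?U) = (\<Sum>j<N. 1)"
  proof (intro sum.cong refl)
    fix j assume "j \<in> {..<N}"
    then have "x \<in> ball 0 r \<Longrightarrow> a j + x \<in> S" for x
      using sub[of j] by (auto simp: dist_norm)
    then have "(\<integral>\<^sup>+x. indicator S (a j + x) \<partial>?U) = (\<integral>\<^sup>+x. 1 \<partial>?U)"
      by (intro nn_integral_cong_AE AE_uniform_measureI) auto
    also have "\<dots> = 1" using U.emeasure_space_1 by (simp only: nn_integral_const mult_1)
    finally show "(\<integral>\<^sup>+x. indicator S (a j + x) \<partial>?U) = 1" .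
  qed
  also have "\<dots> / of_nat N = 1"
    using assms by (simp add: ennreal_divide_self of_nat_less_top)
  finally have S: "emeasure ?\<nu> S = 1" .
  \<comment> \<open>Dropping the restriction to \<open>S\<close> can only increase the energy, and
    the full integrals expand into averages over \<open>j\<close> and \<open>k\<close>.\<close>
  have "(\<integral>\<^sup>+x\<in>S. (\<integral>\<^sup>+y\<in>S. newton_green x y \<partial>?\<nu>) \<partial>?\<nu>) \<le> (\<integral>\<^sup>+x. (\<integral>\<^sup>+y. newton_green x y \<partial>?\<nu>) \<partial>?\<nu>)"
    by (intro nn_integral_mono) (auto simp: indicator_def intro!: nn_integral_mono)
  also have "\<dots> = (\<integral>\<^sup>+x. (\<Sum>k<N. \<integral>\<^sup>+y. newton_green x (a k + y) \<partial>?U) / of_nat N \<partial>?\<nu>)"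
    using assms by (simp add: nn_integral_smeared_points)
  also have "\<dots> = (\<Sum>j<N. \<integral>\<^sup>+x. (\<Sum>k<N. \<integral>\<^sup>+y. newton_green (a j + x) (a k + y) \<partial>?U) / of_nat N \<partial>?U) / of_nat N"
    using assms by (intro nn_integral_smeared_points) auto
  also have "\<dots> = (\<Sum>j<N. \<Sum>k<N. \<integral>\<^sup>+x. \<integral>\<^sup>+y. newton_green (a j + x) (a k + y) \<partial>?U \<partial>?U) / of_nat N / of_nat N"
    by (simp add: nn_integral_divide nn_integral_sum) (simp add: divide_ennreal_def sum_distrib_right)
  finally have "(\<integral>\<^sup>+x\<in>S. (\<integral>\<^sup>+y\<in>S. newton_green x y \<partial>?\<nu>) \<partial>?\<nu>) \<le> \<dots>" .
  moreover have "?\<nu> \<in> {\<nu>. prob_space \<nu> \<and> sets \<nu> = sets borel \<and> emeasure \<nu> S = 1}"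
    using S \<nu>.prob_space_axioms by (simp add: smeared_points_def)
  ultimately show ?thesis
    unfolding newton_capacity_def
    by (intro inverse_ennreal_antimono INF_lower2)
qed

section \<open>Expected energy of Brownian motion along a time grid\<close>

text \<open>
  The summands with \<open>m = 0\<close> vanish because \<open>1 / 0 = 0\<close>, so each pair \<open>j \<noteq> k\<close> is seen by exactly one of
  the truncated differences \<open>j - k\<close> and \<open>k - j\<close>, and the diagonal by neither.
\<close>

definition grid_sum :: "nat \<Rightarrow> nat \<Rightarrow> real" where
  "grid_sum p N = (\<Sum>m<N. 1 / sqrt (real m) ^ p)"

text \<open>Truncated subtraction sends every \<open>k\<close> on the wrong side of \<open>j\<close>
  to 0, where \<open>f\<close> vanishes. The other differences are distinct and below
  \<open>N\<close>, so nonnegativity allows completing the sum.\<close>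

lemma sum_truncated_diff_le:
  fixes f :: "nat \<Rightarrow> real"
  assumes "f 0 = 0" "\<And>m. 0 \<le> f m" "j < N"
  shows "(\<Sum>k<N. f (j - k)) \<le> (\<Sum>m<N. f m)" "(\<Sum>k<N. f (k - j)) \<le> (\<Sum>m<N. f m)"
proof -
  have "(\<Sum>k<N. f (j - k)) = (\<Sum>k\<in>{..<Suc j}. f (j - k))"
    using assms by (intro sum.mono_neutral_right) auto
  also have "\<dots> = (\<Sum>m<Suc j. f m)"
    using sum.nat_diff_reindex[of f "Suc j"] by simp
  also have "\<dots> \<le> (\<Sum>m<N. f m)"
    using assms by (intro sum_mono2) auto
  finally show "(\<Sum>k<N. f (j - k)) \<le> (\<Sum>m<N. f m)" .
  have "(\<Sum>k<N. f (k - j)) = (\<Sum>k\<in>{j..<N}. f (k - j))"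
    using assms by (intro sum.mono_neutral_right) auto
  also have "\<dots> = (\<Sum>m<N - j. f m)"
    using assms by (intro sum.reindex_bij_witness[of _ "\<lambda>m. m + j" "\<lambda>k. k - j"]) auto
  also have "\<dots> \<le> (\<Sum>m<N. f m)"
    using assms by (intro sum_mono2) auto
  finally show "(\<Sum>k<N. f (k - j)) \<le> (\<Sum>m<N. f m)" .
qed

section \<open>Growth of the grid sum in dimensions at least 5 and in dimension 4\<close>

text \<open>For \<open>m \<ge> 1\<close> the summand is largest at \<open>p = 3\<close>, where the
  series converges; at \<open>m = 0\<close> both sides are 0. The bound depends neither on
  \<open>N\<close> nor on \<open>p\<close>.\<close>

lemma grid_sum_le_suminf:
  assumes "3 \<le> p"
  shows "grid_sum p N \<le> (\<Sum>m. real m powr (-3/2))"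
proof -
  have s: "summable (\<lambda>m. real m powr (-3/2))"
    by (subst summable_real_powr_iff) simp
  have "1 / sqrt (real m) ^ p \<le> real m powr (-3/2)" for m
  proof (cases "m = 0")
    case False
    then have "sqrt (real m) ^ 3 \<le> sqrt (real m) ^ p"
      using assms by (intro power_increasing) auto
    then have "1 / sqrt (real m) ^ p \<le> 1 / sqrt (real m) ^ 3"
      using False by (intro divide_left_mono) auto
    also have "sqrt (real m) ^ 3 = real m powr (3 / 2)"
      using False by (simp add: powr_half_sqrt[symmetric] powr_powr flip: powr_realpow)
    finally show ?thesis by (simp add: powr_minus_divide)
  qed (use assms in \<open>simp add: power_0_left\<close>)
  then have "grid_sum p N \<le> (\<Sum>m<N. real m powr (-3/2))"
    unfolding grid_sum_def by (rule sum_mono)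
  also have "\<dots> \<le> (\<Sum>m. real m powr (-3/2))"
    using s by (intro sum_le_suminf) auto
  finally show ?thesis .
qed

lemma grid_sum_2_le_ln:
  assumes "0 < N"
  shows "grid_sum 2 N \<le> 1 + ln (real N)"
proof -
  obtain n where N: "N = Suc n" using assms by (cases N) auto
  have "grid_sum 2 N = (\<Sum>m<Suc n. 1 / real m)"
    unfolding grid_sum_def N by (intro sum.cong) auto
  \<comment> \<open>The term at \<open>m = 0\<close> is \<open>1 / 0 = 0\<close>, so the sum is the
    harmonic number of \<open>N - 1\<close>.\<close>
  also have "\<dots> = (\<Sum>m<n. 1 / real (Suc m))"
    by (simp add: sum.lessThan_Suc_shift del: sum.lessThan_Suc)
  also have "\<dots> = harm n"
    unfolding harm_def by (intro sum.reindex_bij_witness[of _ "\<lambda>m. m - 1" Suc]) (auto simp: field_simps)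
  also have "\<dots> \<le> harm (Suc n)" by (simp add: harm_Suc)
  \<comment> \<open>The sequence \<open>harm (Suc n) - ln (Suc n)\<close> decreases and starts at
    1.\<close>
  also have "\<dots> \<le> 1 + ln (real (Suc n))"
    using decseqD[OF decseq_harm_diff_ln, of 0 n] by (simp add: harm_Suc harm_expand)
  finally show ?thesis using N by simp
qed

section \<open>Mean of the Green function\<close>

text \<open>Here \<open>p\<close> is the dimension minus 2. The maximum covers both small ball
  constants, 1 for the uniform and the unit ball volume for the Gaussian law, so one constant serves
  diagonal and off-diagonal terms.\<close>

definition green_moment_const :: "nat \<Rightarrow> real" where
  "green_moment_const p = Gamma (real p / 2) / (2 * pi powr (real (p + 2) / 2)) *
     (1 + max 1 (unit_ball_vol (real (p + 2))) * 2 ^ (p + 1))"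

lemma green_moment_const_pos: "0 < p \<Longrightarrow> 0 < green_moment_const p"
  unfolding green_moment_const_def
  by (intro mult_pos_pos divide_pos_pos Gamma_real_pos add_pos_nonneg) auto

lemma newton_green_eq:
  fixes x y :: "real ^ 'n"
  assumes "CARD('n) = p + 2"
  shows "newton_green x y = ennreal (Gamma (real p / 2) / (2 * pi powr (real (p + 2) / 2))) *
    inverse (ennreal (norm (x - y) ^ p))"
proof -
  have "real (p + 2) / 2 - 1 = real p / 2" by (simp add: add_divide_distrib)
  then show ?thesis
    unfolding newton_green_def divide_ennreal_def assms by (simp only: diff_add_inverse2)
qed

lemma newton_green_commute: "newton_green x y = newton_green y x"
  by (simp add: newton_green_def norm_minus_commute)

text \<open>Transfers either moment bound to the Green function; \<open>v\<close> is the small ball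
  constant, and \<open>R\<close> stands for the \<open>p\<close>-th power of the length
  scale.\<close>

lemma nn_integral_newton_green_le:
  fixes f g :: "'a \<Rightarrow> real ^ 'n"
  assumes "CARD('n) = p + 2" "0 < p" "0 < R"
    and [measurable]: "f \<in> borel_measurable M" "g \<in> borel_measurable M"
    and le: "(\<integral>\<^sup>+\<omega>. inverse (ennreal (norm (f \<omega> - g \<omega>) ^ p)) \<partial>M) \<le> ennreal ((1 + v * 2 ^ (p + 1)) / R)"
    and v: "v \<le> max 1 (unit_ball_vol (real (p + 2)))"
  shows "(\<integral>\<^sup>+\<omega>. newton_green (f \<omega>) (g \<omega>) \<partial>M) \<le> ennreal (green_moment_const p / R)"
proof -
  let ?\<gamma> = "Gamma (real p / 2) / (2 * pi powr (real (p + 2) / 2))"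
  have \<gamma>: "0 \<le> ?\<gamma>" using \<open>0 < p\<close> by (intro divide_nonneg_nonneg less_imp_le[OF Gamma_real_pos]) auto
  have "(\<integral>\<^sup>+\<omega>. newton_green (f \<omega>) (g \<omega>) \<partial>M) =
      ennreal ?\<gamma> * (\<integral>\<^sup>+\<omega>. inverse (ennreal (norm (f \<omega> - g \<omega>) ^ p)) \<partial>M)"
    by (simp only: newton_green_eq[OF assms(1)]) (rule nn_integral_cmult, measurable)
  also have "\<dots> \<le> ennreal ?\<gamma> * ennreal ((1 + max 1 (unit_ball_vol (real (p + 2))) * 2 ^ (p + 1)) / R)"
    using v \<open>0 < R\<close>
    by (intro mult_left_mono order_trans[OF le] ennreal_leI divide_right_mono add_left_mono mult_right_mono) auto
  also have "\<dots> = ennreal (green_moment_const p / R)"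
    using \<gamma> \<open>0 < R\<close> unfolding green_moment_const_def
    by (subst ennreal_mult[symmetric]) auto
  finally show ?thesis .
qed

text \<open>Serves the diagonal: averaging over one smearing variable suffices, uniformly in the
  fixed points \<open>z\<close> and \<open>b\<close>.\<close>

lemma nn_integral_green_uniform_ball_le:
  fixes z :: "real ^ 'n"
  assumes "CARD('n) = p + 2" "0 < p" "0 < r"
  shows "(\<integral>\<^sup>+y. newton_green z (b + y) \<partial>uniform_measure lborel (ball 0 r))
    \<le> ennreal (green_moment_const p / r ^ p)"
proof (rule nn_integral_newton_green_le[where v = 1])
  have "norm (z - (b + y)) = norm ((b - z) + y)" for y
    by (metis add_diff_eq diff_add_eq norm_minus_commute)
  then show "(\<integral>\<^sup>+y. inverse (ennreal (norm (z - (b + y)) ^ p)) \<partial>uniform_measure lborel (ball 0 r))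
    \<le> ennreal ((1 + 1 * 2 ^ (p + 1)) / r ^ p)"
    using nn_integral_uniform_ball_inverse_norm_power_le[of r p "b - z"] assms by simp
qed (use assms in auto)

lemma nn_integral_green_brownian_le:
  fixes B :: "real \<Rightarrow> 'w \<Rightarrow> real ^ 'n"
  assumes bm: "standard_brownian_motion M B" and "CARD('n) = p + 2" "0 < p"
    and "0 \<le> s" "0 \<le> t" "s \<noteq> t"
  shows "(\<integral>\<^sup>+\<omega>. newton_green (B s \<omega> + x) (B t \<omega> + y) \<partial>M)
    \<le> ennreal (green_moment_const p / sqrt \<bar>s - t\<bar> ^ p)"
proof -
  \<comment> \<open>For ordered times the difference of the arguments is a Gaussian increment
    shifted by \<open>y - x\<close>. Symmetry of the Green function gives the other order.\<close>
  have *: "(\<integral>\<^sup>+\<omega>. newton_green (B t \<omega> + y) (B s \<omega> + x) \<partial>M)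
      \<le> ennreal (green_moment_const p / sqrt (t - s) ^ p)" if "0 \<le> s" "s < t" for s t x y
  proof (rule nn_integral_newton_green_le[where v = "unit_ball_vol (real (p + 2))"])
    have [measurable]: "B s \<in> borel_measurable M" "B t \<in> borel_measurable M"
      using bm that unfolding standard_brownian_motion_def by auto
    show "(\<lambda>\<omega>. B t \<omega> + y) \<in> borel_measurable M" "(\<lambda>\<omega>. B s \<omega> + x) \<in> borel_measurable M"
      by measurable
    have "prob_space M" and
      "distributed M lborel (\<lambda>\<omega>. B t \<omega> - B s \<omega>)
        (\<lambda>x. ennreal (\<Prod>i\<in>UNIV. normal_density 0 (sqrt (t - s)) (x $ i)))"
      using bm that unfolding standard_brownian_motion_def by auto
    from nn_integral_gaussian_inverse_norm_power_le[OF this(1) _ assms(2) this(2), of "y - x"]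
    show "(\<integral>\<^sup>+\<omega>. inverse (ennreal (norm (B t \<omega> + y - (B s \<omega> + x)) ^ p)) \<partial>M)
        \<le> ennreal ((1 + unit_ball_vol (real (p + 2)) * 2 ^ (p + 1)) / sqrt (t - s) ^ p)"
      using that assms(2) by (simp add: algebra_simps)
  qed (use assms that in auto)
  show ?thesis
  proof (cases "s < t")
    case True
    then show ?thesis using *[of s t y x] \<open>0 \<le> s\<close> by (simp add: newton_green_commute)
  next
    case False
    then show ?thesis using *[of t s x y] assms by simp
  qed
qed

text \<open>The spacing \<open>r^2\<close> puts all terms on one scale: the increment over
  \<open>m\<close> steps has size \<open>r * sqrt m\<close>, so \<open>r ^ p\<close> factors out
  just as on the diagonal. Exactly one of the three summands is nonzero.\<close>

lemma expected_energy_term_le: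
  fixes B :: "real \<Rightarrow> 'w \<Rightarrow> real ^ 'n"
  assumes bm: "standard_brownian_motion M B" and d: "CARD('n) = p + 2" "0 < p" and "0 < r"
  defines "U \<equiv> uniform_measure lborel (ball (0 :: real ^ 'n) r)"
  shows "(\<integral>\<^sup>+\<omega>. \<integral>\<^sup>+x. \<integral>\<^sup>+y.
      newton_green (B (real j * r\<^sup>2) \<omega> + x) (B (real k * r\<^sup>2) \<omega> + y) \<partial>U \<partial>U \<partial>M)
    \<le> ennreal (green_moment_const p / r ^ p *
        (of_bool (j = k) + 1 / sqrt (real (j - k)) ^ p + 1 / sqrt (real (k - j)) ^ p))"
proof -
  let ?D = "green_moment_const p"
  interpret U: prob_space U unfolding U_def using \<open>0 < r\<close> by (rule prob_space_uniform_ball)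
  interpret M: prob_space M using bm by (simp add: standard_brownian_motion_def)
  have [measurable_cong]: "sets U = sets borel" by (simp add: U_def)
  have [measurable]: "B (real i * r\<^sup>2) \<in> borel_measurable M" for i
    using bm unfolding standard_brownian_motion_def by simp
  show ?thesis
  proof (cases "j = k")
    case True
    have "(\<integral>\<^sup>+\<omega>. \<integral>\<^sup>+x. \<integral>\<^sup>+y.
        newton_green (B (real j * r\<^sup>2) \<omega> + x) (B (real k * r\<^sup>2) \<omega> + y) \<partial>U \<partial>U \<partial>M)
      \<le> (\<integral>\<^sup>+\<omega>. \<integral>\<^sup>+x. ennreal (?D / r ^ p) \<partial>U \<partial>M)"
      unfolding U_def by (intro nn_integral_mono nn_integral_green_uniform_ball_le assms)
    also have "\<dots> = ennreal (?D / r ^ p)"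
      by (simp add: U.emeasure_space_1 M.emeasure_space_1)
    finally show ?thesis using True d by (simp add: power_0_left)
  next
    case False
    \<comment> \<open>Fubini moves the expectation innermost, where the Gaussian estimate holds for
      fixed smearing variables.\<close>
    interpret MU: pair_sigma_finite M U ..
    have "(\<integral>\<^sup>+\<omega>. \<integral>\<^sup>+x. \<integral>\<^sup>+y.
        newton_green (B (real j * r\<^sup>2) \<omega> + x) (B (real k * r\<^sup>2) \<omega> + y) \<partial>U \<partial>U \<partial>M) =
      (\<integral>\<^sup>+x. \<integral>\<^sup>+\<omega>. \<integral>\<^sup>+y.
        newton_green (B (real j * r\<^sup>2) \<omega> + x) (B (real k * r\<^sup>2) \<omega> + y) \<partial>U \<partial>M \<partial>U)"
      by (rule MU.Fubini'[symmetric]) measurable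
    also have "\<dots> = (\<integral>\<^sup>+x. \<integral>\<^sup>+y. \<integral>\<^sup>+\<omega>.
        newton_green (B (real j * r\<^sup>2) \<omega> + x) (B (real k * r\<^sup>2) \<omega> + y) \<partial>M \<partial>U \<partial>U)"
      by (intro nn_integral_cong MU.Fubini'[symmetric]) measurable
    also have "\<dots> \<le> (\<integral>\<^sup>+x. \<integral>\<^sup>+y. ennreal (?D / sqrt \<bar>real j * r\<^sup>2 - real k * r\<^sup>2\<bar> ^ p) \<partial>U \<partial>U)"
      using False \<open>0 < r\<close> by (intro nn_integral_mono nn_integral_green_brownian_le[OF bm d]) auto
    also have "\<dots> = ennreal (?D / sqrt \<bar>real j * r\<^sup>2 - real k * r\<^sup>2\<bar> ^ p)"
      by (simp add: U.emeasure_space_1)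
    also have "\<bar>real j * r\<^sup>2 - real k * r\<^sup>2\<bar> = r\<^sup>2 * real (j - k + (k - j))"
    proof -
      have "\<bar>real j - real k\<bar> = real (j - k + (k - j))" by auto
      then show ?thesis by (simp add: abs_mult flip: left_diff_distrib)
    qed
    also have "?D / sqrt (r\<^sup>2 * real (j - k + (k - j))) ^ p =
        ?D / r ^ p * (of_bool (j = k) + 1 / sqrt (real (j - k)) ^ p + 1 / sqrt (real (k - j)) ^ p)"
      using False d \<open>0 < r\<close>
      by (cases "j < k") (auto simp: real_sqrt_mult power_mult_distrib power_0_left)
    finally show ?thesis by simp
  qed
qed

text \<open>Each row of the double sum contributes at most 1 from the diagonal and one
  \<open>grid_sum\<close> from either side. Summing \<open>N\<close> rows and dividing by
  \<open>N\<close> twice leaves the factor \<open>1 / N\<close>.\<close>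

lemma expected_energy_le:
  fixes B :: "real \<Rightarrow> 'w \<Rightarrow> real ^ 'n"
  assumes bm: "standard_brownian_motion M B" and d: "CARD('n) = p + 2" "0 < p" and "0 < r" "0 < N"
  defines "U \<equiv> uniform_measure lborel (ball (0 :: real ^ 'n) r)"
  defines "e \<equiv> (\<lambda>\<omega>. (\<Sum>j<N. \<Sum>k<N. \<integral>\<^sup>+x. \<integral>\<^sup>+y.
      newton_green (B (real j * r\<^sup>2) \<omega> + x) (B (real k * r\<^sup>2) \<omega> + y) \<partial>U \<partial>U) / of_nat N / of_nat N)"
  shows "e \<in> borel_measurable M"
    and "(\<integral>\<^sup>+\<omega>. e \<omega> \<partial>M) \<le> ennreal (green_moment_const p * (1 + 2 * grid_sum p N) / (r ^ p * real N))"
proof -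
  let ?\<beta> = "green_moment_const p / r ^ p"
  let ?T = "grid_sum p N"
  let ?f = "\<lambda>m. 1 / sqrt (real m) ^ p"
  interpret U: prob_space U unfolding U_def using \<open>0 < r\<close> by (rule prob_space_uniform_ball)
  interpret M: prob_space M using bm by (simp add: standard_brownian_motion_def)
  have [measurable_cong]: "sets U = sets borel" by (simp add: U_def)
  have [measurable]: "B (real i * r\<^sup>2) \<in> borel_measurable M" for i
    using bm unfolding standard_brownian_motion_def by simp
  show "e \<in> borel_measurable M" unfolding e_def by measurable
  have \<beta>: "0 \<le> ?\<beta>"
    using green_moment_const_pos[OF d(2)] \<open>0 < r\<close> by simp
  have f: "?f 0 = 0" "0 \<le> ?f m" for m
    using d by (auto simp: power_0_left)
  have "(\<integral>\<^sup>+\<omega>. e \<omega> \<partial>M) = (\<Sum>j<N. \<Sum>k<N. \<integral>\<^sup>+\<omega>. \<integral>\<^sup>+x. \<integral>\<^sup>+y.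
      newton_green (B (real j * r\<^sup>2) \<omega> + x) (B (real k * r\<^sup>2) \<omega> + y) \<partial>U \<partial>U \<partial>M) / of_nat N / of_nat N"
    unfolding e_def by (simp add: nn_integral_divide nn_integral_sum)
  also have "\<dots> \<le> (\<Sum>j<N. \<Sum>k<N. ennreal (?\<beta> * (of_bool (j = k) + ?f (j - k) + ?f (k - j))))
      / of_nat N / of_nat N"
    unfolding U_def
    by (intro divide_right_mono_ennreal sum_mono expected_energy_term_le assms)
  also have "(\<Sum>j<N. \<Sum>k<N. ennreal (?\<beta> * (of_bool (j = k) + ?f (j - k) + ?f (k - j)))) =
      ennreal (\<Sum>j<N. \<Sum>k<N. ?\<beta> * (of_bool (j = k) + ?f (j - k) + ?f (k - j)))"
  proof -
    have "(\<Sum>j<N. \<Sum>k<N. ennreal (h j k)) = ennreal (\<Sum>j<N. \<Sum>k<N. h j k)"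
      if "\<And>j k. 0 \<le> h j k" for h :: "nat \<Rightarrow> nat \<Rightarrow> real"
      using that by (simp add: sum_nonneg)
    then show ?thesis
      by this (intro mult_nonneg_nonneg add_nonneg_nonneg \<beta> f, simp)
  qed
  also have "\<dots> / of_nat N / of_nat N \<le> ennreal (real N * (?\<beta> * (1 + 2 * ?T))) / of_nat N / of_nat N"
  proof (intro divide_right_mono_ennreal ennreal_leI)
    have "(\<Sum>k<N. ?\<beta> * (of_bool (j = k) + ?f (j - k) + ?f (k - j))) \<le> ?\<beta> * (1 + 2 * ?T)"
      if "j \<in> {..<N}" for j
    proof -
      have "(\<Sum>k<N. of_bool (j = k) :: real) = (\<Sum>k\<in>{j}. 1)"
        using that by (intro sum.mono_neutral_cong_right) auto
      then have "(\<Sum>k<N. of_bool (j = k) + ?f (j - k) + ?f (k - j)) \<le> 1 + 2 * ?T"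
        using sum_truncated_diff_le[of ?f j N, OF f] that
        by (simp add: sum.distrib grid_sum_def)
      then show ?thesis
        using \<beta> by (simp only: sum_distrib_left[symmetric] mult_left_mono)
    qed
    from sum_bounded_above[of "{..<N}", OF this] show
      "(\<Sum>j<N. \<Sum>k<N. ?\<beta> * (of_bool (j = k) + ?f (j - k) + ?f (k - j))) \<le> real N * (?\<beta> * (1 + 2 * ?T))"
      by simp
  qed
  also have "\<dots> = ennreal (green_moment_const p * (1 + 2 * ?T) / (r ^ p * real N))"
  proof -
    have "0 \<le> ?T" unfolding grid_sum_def by (intro sum_nonneg) auto
    then have "0 \<le> real N * (?\<beta> * (1 + 2 * ?T))"
      by (intro mult_nonneg_nonneg \<beta>) auto
    moreover have "0 < real N" using \<open>0 < N\<close> by simp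
    ultimately have nn: "0 \<le> real N * (?\<beta> * (1 + 2 * ?T))" "0 < real N" .
    have "ennreal (real N * (?\<beta> * (1 + 2 * ?T))) / ennreal (real N) / ennreal (real N) =
        ennreal (real N * (?\<beta> * (1 + 2 * ?T)) / real N / real N)"
      by (simp only: divide_ennreal[OF nn] divide_ennreal[OF divide_nonneg_pos[OF nn] nn(2)])
    also have "real N * (?\<beta> * (1 + 2 * ?T)) / real N / real N = green_moment_const p * (1 + 2 * ?T) / (r ^ p * real N)"
      using \<open>0 < N\<close> by simp
    finally show ?thesis by (simp add: ennreal_of_nat_eq_real_of_nat)
  qed
  finally show "(\<integral>\<^sup>+\<omega>. e \<omega> \<partial>M) \<le> ennreal (green_moment_const p * (1 + 2 * ?T) / (r ^ p * real N))" .
qed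

section \<open>The capacity bound\<close>

theorem lemma4p4:
  assumes "CARD('n::finite) \<ge> 4"
  shows "\<exists>c::real. c > 0 \<and>
    (\<forall>(M :: 'w measure) (B :: real \<Rightarrow> 'w \<Rightarrow> real ^ 'n) (c\<^sub>B::real) (t::real) (r::real).
       standard_brownian_motion M B \<and> c\<^sub>B > 0 \<and> t \<ge> 1 \<and> 0 < r \<and> r < 1 \<longrightarrow>
       (\<integral>\<^sup>+\<omega>. newton_capacity (wiener_sausage B r t \<omega>)
               * indicator (confinement_event M B c\<^sub>B t r) \<omega> \<partial>M)
         \<ge> ennreal (c * (measure M (confinement_event M B c\<^sub>B t r))\<^sup>2
               * sausage_capacity_rate CARD('n) t r))"
proof -
  define p where "p = CARD('n) - 2"
  have d: "CARD('n) = p + 2" "0 < p" and "2 \<le> p" using assms by (auto simp: p_def)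
  define D where "D = green_moment_const p"
  define Z where "Z = (\<Sum>m. real m powr (-3/2))"
  have D: "0 < D" unfolding D_def using d(2) by (rule green_moment_const_pos)
  have Z: "0 \<le> Z" unfolding Z_def
    by (intro suminf_nonneg) (auto simp: summable_real_powr_iff)
  \<comment> \<open>\<open>D\<close> comes from the energy bound, \<open>5 + 2 * Z\<close> dominates
    the grid sums in all dimensions, and 2 pays for rounding \<open>t / r^2\<close> down. All are
    fixed before \<open>M\<close>, \<open>B\<close> and \<open>c\<^sub>B\<close>.\<close>
  define c where "c = 1 / (2 * D * (5 + 2 * Z))"
  have "0 < c" using D Z by (simp add: c_def)
  moreover have "ennreal (c * (measure M (confinement_event M B c\<^sub>B t r))\<^sup>2 * sausage_capacity_rate CARD('n) t r)
      \<le> (\<integral>\<^sup>+\<omega>. newton_capacity (wiener_sausage B r t \<omega>) * indicator (confinement_event M B c\<^sub>B t r) \<omega> \<partial>M)"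
    if bm: "standard_brownian_motion M B" and "1 \<le> t" "0 < r" "r < 1"
    for M :: "'w measure" and B :: "real \<Rightarrow> 'w \<Rightarrow> real ^ 'n" and c\<^sub>B t r :: real
  proof (cases "confinement_event M B c\<^sub>B t r \<in> sets M")
    \<comment> \<open>Outside \<open>sets M\<close> the function \<open>measure\<close> has the
      default value 0, so the bound is trivial.\<close>
    case False
    then show ?thesis by (simp add: measure_notin_sets)
  next
    case True
    interpret prob_space M using bm by (simp add: standard_brownian_motion_def)
    let ?P = "prob (confinement_event M B c\<^sub>B t r)"
    \<comment> \<open>As \<open>t / r^2\<close> is at least 1, rounding down gives a positive number
      and loses at most a factor 2.\<close>
    define N where "N = nat \<lfloor>t / r\<^sup>2\<rfloor>"
    have "r\<^sup>2 < 1" using \<open>0 < r\<close> \<open>r < 1\<close> by (simp add: power_less_one_iff)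
    then have ge1: "1 \<le> t / r\<^sup>2" using \<open>1 \<le> t\<close> \<open>0 < r\<close> by simp
    then have "1 \<le> \<lfloor>t / r\<^sup>2\<rfloor>" by simp
    moreover from this have "real N = of_int \<lfloor>t / r\<^sup>2\<rfloor>" by (simp add: N_def)
    ultimately have N: "0 < N" "real N \<le> t / r\<^sup>2" "t / r\<^sup>2 \<le> 2 * real N"
      unfolding N_def by linarith+
    \<comment> \<open>\<open>L\<close> merges the two rates; for \<open>p = 2\<close> the power
      \<open>r ^ (p - 2)\<close> is 1.\<close>
    define L where "L = (if 3 \<le> p then 1 else max 1 (ln (t * r powi (-2))))"
    have L: "1 \<le> L" by (auto simp: L_def)
    have rate: "sausage_capacity_rate CARD('n) t r = t * r ^ (p - 2) / L"
      using d \<open>2 \<le> p\<close> by (auto simp: sausage_capacity_rate_def L_def)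
    have T: "1 + 2 * grid_sum p N \<le> (5 + 2 * Z) * L"
    proof (cases "3 \<le> p")
      case True
      then show ?thesis using grid_sum_le_suminf[OF True, of N] Z by (simp add: L_def Z_def)
    next
      case False
      then have "p = 2" using \<open>2 \<le> p\<close> by simp
      have "ln (real N) \<le> ln (t * r powi (-2))"
        using N ge1 by (intro ln_mono) (auto simp: power_int_minus field_simps)
      then have "ln (real N) \<le> L" using \<open>p = 2\<close> by (simp add: L_def)
      \<comment> \<open>The left side is at most \<open>3 + 2 * ln N\<close>, and both 1 and
        \<open>ln N\<close> are at most \<open>L\<close>.\<close>
      then have "1 + 2 * grid_sum p N \<le> 5 * L"
        using grid_sum_2_le_ln[OF N(1)] L \<open>p = 2\<close> by simp
      also have "\<dots> \<le> (5 + 2 * Z) * L" using Z L by (intro mult_right_mono) auto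
      finally show ?thesis .
    qed
    define K where "K = D * (1 + 2 * grid_sum p N) / (r ^ p * real N)"
    have "0 \<le> grid_sum p N" unfolding grid_sum_def by (intro sum_nonneg) auto
    then have K: "0 < K" unfolding K_def using D N \<open>0 < r\<close> by simp
    have "c * ?P\<^sup>2 * sausage_capacity_rate CARD('n) t r \<le> ?P\<^sup>2 / K"
    proof -
      \<comment> \<open>It is enough that \<open>K * c\<close> times the rate is at most 1. Insert
        the bound on the grid sum and \<open>N \<ge> t / r^2 / 2\<close>; then \<open>t\<close> and
        \<open>L\<close> cancel, the powers of \<open>r\<close> cancel, and \<open>c\<close> absorbs
        the constants.\<close>
      have "K * (c * (t * r ^ (p - 2) / L)) \<le>
          (D * ((5 + 2 * Z) * L) / (r ^ p * (t / r\<^sup>2 / 2))) * (c * (t * r ^ (p - 2) / L))"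
        unfolding K_def using D N T L \<open>0 < c\<close> \<open>0 < r\<close> \<open>1 \<le> t\<close> \<open>0 \<le> grid_sum p N\<close>
        by (intro mult_right_mono frac_le mult_left_mono) auto
      also have "\<dots> = (c * (2 * D * (5 + 2 * Z))) * (r\<^sup>2 * r ^ (p - 2) / r ^ p)"
        using L \<open>0 < r\<close> \<open>1 \<le> t\<close> by (simp add: field_simps)
      also have "r\<^sup>2 * r ^ (p - 2) = r ^ p"
        using \<open>2 \<le> p\<close> by (metis le_add_diff_inverse power_add)
      also have "c * (2 * D * (5 + 2 * Z)) * (r ^ p / r ^ p) = 1"
        using D Z \<open>0 < r\<close> by (simp add: c_def)
      finally have "c * (t * r ^ (p - 2) / L) \<le> 1 / K"
        using K by (simp add: field_simps)
      then have "?P\<^sup>2 * (c * (t * r ^ (p - 2) / L)) \<le> ?P\<^sup>2 * (1 / K)"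
        by (intro mult_left_mono) auto
      then show ?thesis unfolding rate by (simp add: mult_ac)
    qed
    then have "ennreal (c * ?P\<^sup>2 * sausage_capacity_rate CARD('n) t r) \<le> ennreal (?P\<^sup>2 / K)"
      by (rule ennreal_leI)
    also have "\<dots> \<le> (\<integral>\<^sup>+\<omega>. newton_capacity (wiener_sausage B r t \<omega>) *
        indicator (confinement_event M B c\<^sub>B t r) \<omega> \<partial>M)"
    \<comment> \<open>The confinement event enters only as a measurable set with its probability;
      the energy is averaged over the whole space.\<close>
    proof (rule nn_integral_ge_square_prob_div[OF True expected_energy_le(1)[OF bm d \<open>0 < r\<close> N(1)] _ K])
      show "(\<integral>\<^sup>+\<omega>. (\<Sum>j<N. \<Sum>k<N. \<integral>\<^sup>+x. \<integral>\<^sup>+y.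
          newton_green (B (real j * r\<^sup>2) \<omega> + x) (B (real k * r\<^sup>2) \<omega> + y)
          \<partial>uniform_measure lborel (ball 0 r) \<partial>uniform_measure lborel (ball 0 r)) / of_nat N / of_nat N \<partial>M)
        \<le> ennreal K"
        unfolding K_def D_def by (rule expected_energy_le(2)[OF bm d \<open>0 < r\<close> N(1)])
      fix \<omega>
      show "inverse ((\<Sum>j<N. \<Sum>k<N. \<integral>\<^sup>+x. \<integral>\<^sup>+y.
          newton_green (B (real j * r\<^sup>2) \<omega> + x) (B (real k * r\<^sup>2) \<omega> + y)
          \<partial>uniform_measure lborel (ball 0 r) \<partial>uniform_measure lborel (ball 0 r)) / of_nat N / of_nat N)
        \<le> newton_capacity (wiener_sausage B r t \<omega>)"
      proof (rule newton_capacity_ge[OF \<open>0 < r\<close> N(1)])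
        show "wiener_sausage B r t \<omega> \<in> sets borel"
          unfolding wiener_sausage_def by (intro borel_open open_UN ballI open_ball)
        fix j assume "j < N"
        then have "real j \<le> t / r\<^sup>2" using N by linarith
        then have "real j * r\<^sup>2 \<in> {0..t}" using \<open>0 < r\<close> by (simp add: field_simps)
        then show "ball (B (real j * r\<^sup>2) \<omega>) r \<subseteq> wiener_sausage B r t \<omega>"
          unfolding wiener_sausage_def by blast
      qed
    qed
    finally show ?thesis .
  qed
  ultimately show ?thesis by blast
qed

end
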